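(* Let $(M,d_M)$ be a complete, separable metric space, let $(X,d_X)$ be a metric space, and let $\{\mu_x\}_{x\in X}$ be a family of Borel probability measures on $M$ parametrised by $X$. If the family $\{\mu_x\}_{x\in X}$ is boundedly Lipschitz representable, then $$\sup_{x,y\in X,\ x\neq y}\frac{W_\infty(\mu_x,\mu_y)}{d_X(x,y)}<\infty.$$
   Context: For Borel probability measures $\mu,\bar\mu$ on $M$, $\Pi(\mu,\bar\mu)$ denotes the set of Borel probability measures on $M\times M$ with marginals $\mu$ and $\bar\mu$, and the supremum Wasserstein distance is $$W_\infty(\mu,\bar\mu)=\inf_{\pi\in\Pi(\mu,\bar\mu)}\ \operatorname*{ess\,sup}_{(m_1,m_2)\in(M\times M,\pi)} d_M(m_1,m_2),$$ the essential supremum being taken with respect to $\pi$. The family $\{\mu_x\}_{x\in X}$ is boundedly Lipschitz representable if there exist a probability space $(\Omega,\mathbb{P})$, a measurable map $T:X\times\Omega\to M$ and a constant $L>0$ such that $T(x,\cdot)_*\mathbb{P}=\mu_x$ (push-forward) for every $x\in X$, and for $\mathbb{P}$-a.e. $\omega\in\Omega$ the map $T(\cdot,\omega):X\to M$ is Lipschitz with Lipschitz constant at most $L$. *)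

theory Defs
  imports "HOL-Probability.Probability"
begin

definition couplings ::
    "'m::topological_space measure \<Rightarrow> 'm measure \<Rightarrow> ('m \<times> 'm) measure set"
  where "couplings \<mu> \<nu> = {\<pi>. prob_space \<pi> \<and> sets \<pi> = sets borel \<and>
           distr \<pi> borel fst = \<mu> \<and> distr \<pi> borel snd = \<nu>}"

(* Valued in the extended nonnegative reals, since the essential supremum of the distance
   may be infinite for every coupling. *)
definition W_infinity :: "'m::metric_space measure \<Rightarrow> 'm measure \<Rightarrow> ennreal"
  where "W_infinity \<mu> \<nu> =
           (INF \<pi>\<in>couplings \<mu> \<nu>. esssup \<pi> (\<lambda>(m1, m2). ennreal (dist m1 m2)))"

(* HOL cannot quantify existentially over types, so the type 'w of the sample points of the
   probability space P is a parameter. In a hypothesis with 'w a free type variable, the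
   implicit universal quantification over 'w yields the intended existential over all
   probability spaces. *)
definition boundedly_Lipschitz_representable ::
    "'w itself \<Rightarrow> ('x::metric_space \<Rightarrow> 'm::metric_space measure) \<Rightarrow> bool"
  where "boundedly_Lipschitz_representable _ \<mu> \<longleftrightarrow>
           (\<exists>(P :: 'w measure) (T :: 'x \<times> 'w \<Rightarrow> 'm) (L :: real).
              prob_space P \<and>
              T \<in> borel \<Otimes>\<^sub>M P \<rightarrow>\<^sub>M borel \<and>
              L > 0 \<and>
              (\<forall>x. distr P borel (\<lambda>\<omega>. T (x, \<omega>)) = \<mu> x) \<and>
              (AE \<omega> in P. L-lipschitz_on UNIV (\<lambda>x. T (x, \<omega>))))"

end

theory Submission
  imports Defs
begin

text \<open>
  A Lipschitz representation couples all the measures \<open>\<mu> x\<close> at once: for two points \<open>x\<close> and \<open>y\<close>, the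
  joint law of \<open>T (x, \<omega>)\<close> and \<open>T (y, \<omega>)\<close>, driven by the same random \<open>\<omega>\<close>, is a coupling of \<open>\<mu> x\<close> and
  \<open>\<mu> y\<close>. Almost every sample map is \<open>L\<close>-Lipschitz, so this coupling is carried by pairs at distance
  at most \<open>L * dist x y\<close>. Hence \<open>W_infinity (\<mu> x) (\<mu> y) \<le> L * dist x y\<close> for all \<open>x\<close> and \<open>y\<close>, and \<open>L\<close>
  bounds every quotient.
\<close>

text \<open>
  Second countability makes the Borel sets of the product coincide with the product of the Borel
  sets, so that a pair of random variables has a law on the Borel sets of the product.
\<close>
lemma joint_law_in_couplings:
  fixes f g :: "'w \<Rightarrow> 'm::second_countable_topology"
  assumes "prob_space P"
    and [measurable]: "f \<in> P \<rightarrow>\<^sub>M borel" "g \<in> P \<rightarrow>\<^sub>M borel"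
  shows "distr P borel (\<lambda>\<omega>. (f \<omega>, g \<omega>)) \<in> couplings (distr P borel f) (distr P borel g)"
proof -
  interpret prob_space P by fact
  have pair: "(\<lambda>\<omega>. (f \<omega>, g \<omega>)) \<in> P \<rightarrow>\<^sub>M borel"
    by (rule borel_measurable_Pair) measurable
  have proj: "fst \<in> (borel :: ('m \<times> 'm) measure) \<rightarrow>\<^sub>M borel" "snd \<in> (borel :: ('m \<times> 'm) measure) \<rightarrow>\<^sub>M borel"
    by (auto intro!: borel_measurable_continuous_onI continuous_intros)
  show ?thesis
    unfolding couplings_def
    using pair proj by (simp add: prob_space_distr distr_distr comp_def)
qed

lemma W_infinity_distr_le:
  fixes f g :: "'w \<Rightarrow> 'm::{metric_space, second_countable_topology}"
  assumes "prob_space P"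
    and [measurable]: "f \<in> P \<rightarrow>\<^sub>M borel" "g \<in> P \<rightarrow>\<^sub>M borel"
    and bound: "AE \<omega> in P. dist (f \<omega>) (g \<omega>) \<le> c"
  shows "W_infinity (distr P borel f) (distr P borel g) \<le> ennreal c"
proof -
  let ?\<pi> = "distr P borel (\<lambda>\<omega>. (f \<omega>, g \<omega>))"
  let ?d = "\<lambda>(m1 :: 'm, m2). ennreal (dist m1 m2)"
  have pair: "(\<lambda>\<omega>. (f \<omega>, g \<omega>)) \<in> P \<rightarrow>\<^sub>M borel"
    by (rule borel_measurable_Pair) measurable
  have dist_meas: "?d \<in> borel \<rightarrow>\<^sub>M borel"
    unfolding case_prod_beta
    by (intro borel_measurable_continuous_onI continuous_on_ennreal continuous_intros)
  have "{p. ?d p \<le> ennreal c} \<in> sets borel"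
    using dist_meas by measurable
  then have "AE p in ?\<pi>. ?d p \<le> ennreal c"
    using bound by (subst AE_distr_iff[OF pair]) (auto simp: ennreal_leI)
  then have "esssup ?\<pi> ?d \<le> ennreal c"
    using dist_meas by (intro esssup_I) auto
  moreover have "W_infinity (distr P borel f) (distr P borel g) \<le> esssup ?\<pi> ?d"
    unfolding W_infinity_def
    using joint_law_in_couplings[OF assms(1-3)] by (rule INF_lower)
  ultimately show ?thesis by (rule order_trans[rotated])
qed

theorem theorem7p1:
  fixes \<mu> :: "'x::metric_space \<Rightarrow> 'm::polish_space measure"
  assumes "\<And>x. prob_space (\<mu> x)"
    and "\<And>x. sets (\<mu> x) = sets borel"
    and "boundedly_Lipschitz_representable TYPE('w) \<mu>"
  shows "(SUP (x, y)\<in>{(x, y). x \<noteq> y}. W_infinity (\<mu> x) (\<mu> y) / ennreal (dist x y)) < \<infinity>"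
proof -
  from assms(3) obtain P :: "'w measure" and T :: "'x \<times> 'w \<Rightarrow> 'm" and L :: real
    where P: "prob_space P" and T: "T \<in> borel \<Otimes>\<^sub>M P \<rightarrow>\<^sub>M borel" and L: "L > 0"
      and law: "\<And>x. distr P borel (\<lambda>\<omega>. T (x, \<omega>)) = \<mu> x"
      and lip: "AE \<omega> in P. L-lipschitz_on UNIV (\<lambda>x. T (x, \<omega>))"
    unfolding boundedly_Lipschitz_representable_def by blast
  have T_section: "(\<lambda>\<omega>. T (x, \<omega>)) \<in> P \<rightarrow>\<^sub>M borel" for x
    using T by (rule measurable_compose[rotated]) (simp add: measurable_Pair1')
  have quotient_le: "W_infinity (\<mu> x) (\<mu> y) / ennreal (dist x y) \<le> ennreal L" if "x \<noteq> y" for x y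
  proof -
    have "AE \<omega> in P. dist (T (x, \<omega>)) (T (y, \<omega>)) \<le> L * dist x y"
      using lip by eventually_elim (auto dest: lipschitz_onD)
    from W_infinity_distr_le[OF P T_section T_section this]
    have "W_infinity (\<mu> x) (\<mu> y) \<le> ennreal (L * dist x y)"
      by (simp add: law)
    then have "W_infinity (\<mu> x) (\<mu> y) / ennreal (dist x y)
        \<le> ennreal (L * dist x y) / ennreal (dist x y)"
      by (rule divide_right_mono_ennreal)
    also have "\<dots> = ennreal L"
      using L that by (simp add: divide_ennreal)
    finally show ?thesis .
  qed
  have "(SUP (x, y)\<in>{(x, y). x \<noteq> y}. W_infinity (\<mu> x) (\<mu> y) / ennreal (dist x y)) \<le> ennreal L"
    by (rule SUP_least) (auto intro: quotient_le)
  also have "\<dots> < \<infinity>" by simp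
  finally show ?thesis .
qed

end
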